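(* There exist a Hilbert space $X$ and a symmetric convex compact set $K\subset X$ such that the greedy algorithm applied to $K$ satisfies $$\sigma_n(K)_X\eqsim\sqrt n\,\varepsilon_n(K)_X ,$$ i.e. there are constants $c,C>0$ independent of $n$ with $c\sqrt n\,\varepsilon_n(K)_X\le\sigma_n(K)_X\le C\sqrt n\,\varepsilon_n(K)_X$ for all $n\ge1$.
   Context: For a subspace $U\subset X$ and $f\in X$, $\mathrm{dist}(f,U)=\inf_{g\in U}\|f-g\|_X$. Greedy algorithm: set $X_0=\{0\}$; for $n=1,2,\dots$ choose $f_n\in\arg\max_{f\in K}\mathrm{dist}(f,X_{n-1})$ and set $X_n=\mathrm{span}\{f_1,\dots,f_n\}$. Its error is $\sigma_n(K)_X:=\sup_{f\in K}\mathrm{dist}(f,X_n)$. (Dyadic) entropy numbers: $\varepsilon_n(K)_X=\inf\{\varepsilon>0:\ K\text{ is covered by }2^n\text{ balls of }X\text{ of radius }\varepsilon\}$. *)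

theory Defs
  imports "HOL-Analysis.Analysis"
begin

text \<open>
  HOL cannot quantify existentially over types, so the Hilbert space is the sequence space
  $\ell^2$ over the reals; the remaining notions are defined for every normed space.  Nothing is lost:
  a compact set spans a separable subspace, and every separable Hilbert space embeds
  isometrically into $\ell^2$.
\<close>

typedef l2 = "{x :: nat \<Rightarrow> real. summable (\<lambda>i. (x i)\<^sup>2)}"
  by (rule exI[of _ "\<lambda>_. 0"]) simp

setup_lifting type_definition_l2

lemma l2_summable_mult:
  fixes x y :: "nat \<Rightarrow> real"
  assumes "summable (\<lambda>i. (x i)\<^sup>2)" "summable (\<lambda>i. (y i)\<^sup>2)"
  shows "summable (\<lambda>i. x i * y i)"
proof (rule summable_comparison_test')
  show "summable (\<lambda>i. (x i)\<^sup>2 + (y i)\<^sup>2)"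
    using assms by (rule summable_add)
  show "norm (x i * y i) \<le> (x i)\<^sup>2 + (y i)\<^sup>2" for i
  proof -
    have "2 * \<bar>x i * y i\<bar> \<le> (x i)\<^sup>2 + (y i)\<^sup>2"
      using sum_squares_bound[of "\<bar>x i\<bar>" "\<bar>y i\<bar>"] by (simp add: abs_mult)
    moreover have "0 \<le> \<bar>x i * y i\<bar>" by (rule abs_ge_zero)
    ultimately show ?thesis unfolding real_norm_def by linarith
  qed
qed

lemma l2_summable_add:
  fixes x y :: "nat \<Rightarrow> real"
  assumes "summable (\<lambda>i. (x i)\<^sup>2)" "summable (\<lambda>i. (y i)\<^sup>2)"
  shows "summable (\<lambda>i. (x i + y i)\<^sup>2)"
proof -
  have "summable (\<lambda>i. (x i)\<^sup>2 + (y i)\<^sup>2 + 2 * (x i * y i))"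
    by (intro summable_add summable_mult l2_summable_mult assms)
  then show ?thesis by (simp add: power2_sum mult.assoc)
qed

instantiation l2 :: real_inner
begin

lift_definition zero_l2 :: l2 is "\<lambda>_. 0" by simp

lift_definition plus_l2 :: "l2 \<Rightarrow> l2 \<Rightarrow> l2" is "\<lambda>x y i. x i + y i"
  by (rule l2_summable_add)

lift_definition uminus_l2 :: "l2 \<Rightarrow> l2" is "\<lambda>x i. - x i" by simp

lift_definition minus_l2 :: "l2 \<Rightarrow> l2 \<Rightarrow> l2" is "\<lambda>x y i. x i - y i"
proof -
  fix x y :: "nat \<Rightarrow> real"
  assume "summable (\<lambda>i. (x i)\<^sup>2)" "summable (\<lambda>i. (y i)\<^sup>2)"
  then show "summable (\<lambda>i. (x i - y i)\<^sup>2)"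
    using l2_summable_add[of x "\<lambda>i. - y i"] by simp
qed

lift_definition scaleR_l2 :: "real \<Rightarrow> l2 \<Rightarrow> l2" is "\<lambda>c x i. c * x i"
  by (simp add: power_mult_distrib summable_mult)

lift_definition inner_l2 :: "l2 \<Rightarrow> l2 \<Rightarrow> real" is "\<lambda>x y. \<Sum>i. x i * y i" .

definition norm_l2 :: "l2 \<Rightarrow> real" where "norm_l2 x = sqrt (inner x x)"
definition dist_l2 :: "l2 \<Rightarrow> l2 \<Rightarrow> real" where "dist_l2 x y = norm (x - y)"
definition sgn_l2 :: "l2 \<Rightarrow> l2" where "sgn_l2 x = inverse (norm x) *\<^sub>R x"
definition uniformity_l2 :: "(l2 \<times> l2) filter"
  where "uniformity_l2 = (INF e\<in>{0<..}. principal {(x, y). dist x y < e})"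
definition open_l2 :: "l2 set \<Rightarrow> bool"
  where "open_l2 U = (\<forall>x\<in>U. eventually (\<lambda>(x', y). x' = x \<longrightarrow> y \<in> U) uniformity)"

instance
proof
  fix x y z :: l2 and a b :: real
  show "x + y + z = x + (y + z)" by transfer (simp add: add.assoc)
  show "x + y = y + x" by transfer (simp add: add.commute)
  show "0 + x = x" by transfer simp
  show "- x + x = 0" by transfer simp
  show "x - y = x + - y" by transfer simp
  show "a *\<^sub>R (x + y) = a *\<^sub>R x + a *\<^sub>R y" by transfer (simp add: distrib_left)
  show "(a + b) *\<^sub>R x = a *\<^sub>R x + b *\<^sub>R x" by transfer (simp add: distrib_right)
  show "a *\<^sub>R b *\<^sub>R x = (a * b) *\<^sub>R x" by transfer (simp add: mult.assoc)
  show "1 *\<^sub>R x = x" by transfer simp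
  show "sgn x = inverse (norm x) *\<^sub>R x" by (rule sgn_l2_def)
  show "dist x y = norm (x - y)" by (rule dist_l2_def)
  show "norm x = sqrt (inner x x)" by (rule norm_l2_def)
  show "uniformity = (INF e\<in>{0<..}. principal {(x, y::l2). dist x y < e})"
    by (rule uniformity_l2_def)
  show "open U = (\<forall>x\<in>U. eventually (\<lambda>(x', y). x' = x \<longrightarrow> y \<in> U) uniformity)" for U :: "l2 set"
    by (rule open_l2_def)
  show "inner x y = inner y x" by transfer (simp add: mult.commute)
  show "inner (x + y) z = inner x z + inner y z"
    by transfer (simp add: distrib_right suminf_add l2_summable_mult)
  show "inner (a *\<^sub>R x) y = a * inner x y"
    by transfer (simp add: mult.assoc suminf_mult l2_summable_mult)
  show "0 \<le> inner x x"
    by transfer (simp add: suminf_nonneg flip: power2_eq_square)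
  show "inner x x = 0 \<longleftrightarrow> x = 0"
    by transfer (auto simp: suminf_eq_zero_iff fun_eq_iff simp flip: power2_eq_square)
qed

end

lemma l2_norm_power2: "(norm x)\<^sup>2 = (\<Sum>i. (Rep_l2 x i)\<^sup>2)"
  unfolding power2_norm_eq_inner by transfer (simp add: power2_eq_square)

lemma l2_sum_le_norm: "(\<Sum>i\<in>I. (Rep_l2 x i)\<^sup>2) \<le> (norm x)\<^sup>2" if "finite I"
  unfolding l2_norm_power2 using that Rep_l2[of x] by (intro sum_le_suminf) auto

instance l2 :: complete_space
proof
  fix X :: "nat \<Rightarrow> l2"
  assume C: "Cauchy X"
  have "Cauchy (\<lambda>n. Rep_l2 (X n) i)" for i
  proof (rule metric_CauchyI)
    fix e :: real assume "e > 0"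
    with C obtain M where M: "\<And>m n. m \<ge> M \<Longrightarrow> n \<ge> M \<Longrightarrow> dist (X m) (X n) < e"
      unfolding Cauchy_def by blast
    have "dist (Rep_l2 (X m) i) (Rep_l2 (X n) i) \<le> dist (X m) (X n)" for m n
      using l2_sum_le_norm[of "{i}" "X m - X n"]
      by (simp add: dist_norm minus_l2.rep_eq flip: abs_le_square_iff)
    with M show "\<exists>M. \<forall>m\<ge>M. \<forall>n\<ge>M. dist (Rep_l2 (X m) i) (Rep_l2 (X n) i) < e"
      by (meson le_less_trans)
  qed
  then obtain L where L: "\<And>i. (\<lambda>n. Rep_l2 (X n) i) \<longlonglongrightarrow> L i"
    unfolding Cauchy_convergent_iff convergent_def by metis
  have near: "\<exists>M. \<forall>n\<ge>M. \<forall>N. (\<Sum>i<N. (Rep_l2 (X n) i - L i)\<^sup>2) \<le> e\<^sup>2" if "e > 0" for e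
  proof -
    from C that obtain M where M: "\<And>m n. m \<ge> M \<Longrightarrow> n \<ge> M \<Longrightarrow> dist (X m) (X n) < e"
      unfolding Cauchy_def by blast
    have "(\<Sum>i<N. (Rep_l2 (X n) i - L i)\<^sup>2) \<le> e\<^sup>2" if "n \<ge> M" for n N
    proof (rule tendsto_upperbound)
      show "(\<lambda>m. \<Sum>i<N. (Rep_l2 (X n) i - Rep_l2 (X m) i)\<^sup>2)
              \<longlonglongrightarrow> (\<Sum>i<N. (Rep_l2 (X n) i - L i)\<^sup>2)"
        by (intro tendsto_intros L)
      have "(\<Sum>i<N. (Rep_l2 (X n) i - Rep_l2 (X m) i)\<^sup>2) \<le> e\<^sup>2" if "m \<ge> M" for m
      proof -
        have "(\<Sum>i<N. (Rep_l2 (X n) i - Rep_l2 (X m) i)\<^sup>2) \<le> (norm (X n - X m))\<^sup>2"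
          using l2_sum_le_norm[of "{..<N}" "X n - X m"] by (simp add: minus_l2.rep_eq)
        also have "\<dots> \<le> e\<^sup>2"
          using M[OF \<open>n \<ge> M\<close> that] by (intro power_mono) (auto simp: dist_norm)
        finally show ?thesis .
      qed
      then show "\<forall>\<^sub>F m in sequentially. (\<Sum>i<N. (Rep_l2 (X n) i - Rep_l2 (X m) i)\<^sup>2) \<le> e\<^sup>2"
        by (auto simp: eventually_sequentially)
    qed simp
    then show ?thesis by blast
  qed
  have sm: "summable (\<lambda>i. (Rep_l2 (X n) i - L i)\<^sup>2)"
    if "\<forall>N. (\<Sum>i<N. (Rep_l2 (X n) i - L i)\<^sup>2) \<le> b" for n b
    using that by (intro summableI_nonneg_bounded[where x = b]) auto
  from near[of 1] obtain M where "\<forall>N. (\<Sum>i<N. (Rep_l2 (X M) i - L i)\<^sup>2) \<le> 1"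
    by fastforce
  from sm[OF this] have "summable (\<lambda>i. (L i - Rep_l2 (X M) i)\<^sup>2)"
    by (simp add: power2_commute)
  from l2_summable_add[OF this, of "Rep_l2 (X M)"] have "summable (\<lambda>i. (L i)\<^sup>2)"
    using Rep_l2[of "X M"] by simp
  then have RepL: "Rep_l2 (Abs_l2 L) = L"
    by (simp add: Abs_l2_inverse)
  have "X \<longlonglongrightarrow> Abs_l2 L"
  proof (rule metric_LIMSEQ_I)
    fix r :: real assume "r > 0"
    then obtain M where M: "\<And>n N. n \<ge> M \<Longrightarrow> (\<Sum>i<N. (Rep_l2 (X n) i - L i)\<^sup>2) \<le> (r/2)\<^sup>2"
      using near[of "r/2"] by auto
    have "dist (X n) (Abs_l2 L) < r" if "n \<ge> M" for n
    proof -
      have "(norm (X n - Abs_l2 L))\<^sup>2 \<le> (r/2)\<^sup>2"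
        unfolding l2_norm_power2 minus_l2.rep_eq RepL
        using M[OF that] by (intro suminf_le_const sm) auto
      then have "norm (X n - Abs_l2 L) \<le> r/2"
        by (rule power2_le_imp_le) (use \<open>r > 0\<close> in simp)
      with \<open>r > 0\<close> show ?thesis by (simp add: dist_norm)
    qed
    then show "\<exists>M. \<forall>n\<ge>M. dist (X n) (Abs_l2 L) < r" by blast
  qed
  then show "convergent X" by (rule convergentI)
qed

definition greedy_space :: "(nat \<Rightarrow> 'a::real_normed_vector) \<Rightarrow> nat \<Rightarrow> 'a set"
  where "greedy_space f n = span (f ` {1..n})"

text \<open>
  The maximizer need not be unique, so the algorithm is a relation between \<open>K\<close> and the
  selected sequence, whose entry at index 0 is irrelevant.  Since a span is nonempty,
  \<^const>\<open>infdist\<close> is the infimum of the distances to its points.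
\<close>

definition greedy_run :: "'a::real_normed_vector set \<Rightarrow> (nat \<Rightarrow> 'a) \<Rightarrow> bool"
  where "greedy_run K f \<longleftrightarrow>
    (\<forall>n\<ge>1. is_arg_max (\<lambda>x. infdist x (greedy_space f (n - 1))) (\<lambda>x. x \<in> K) (f n))"

definition greedy_error :: "'a::real_normed_vector set \<Rightarrow> (nat \<Rightarrow> 'a) \<Rightarrow> nat \<Rightarrow> real"
  where "greedy_error K f n = (SUP x\<in>K. infdist x (greedy_space f n))"

text \<open>The centres may repeat and may lie outside \<open>K\<close>.\<close>

definition entropy_number :: "'a::real_normed_vector set \<Rightarrow> nat \<Rightarrow> real"
  where "entropy_number K n =
    Inf {\<epsilon>. 0 < \<epsilon> \<and> (\<exists>z :: nat \<Rightarrow> 'a. K \<subseteq> (\<Union>i<2 ^ n. cball (z i) \<epsilon>))}"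

end

theory Submission
  imports Defs
begin

text \<open>
  Take $K = \{x : \sum_i (i+1)^2 |x_i| \le 1\}$, the closed convex hull of the points
  $\pm a_i e_i$ with $a_i = (i+1)^{-2}$.  Since $a_i$ is strictly decreasing, the greedy algorithm
  must choose $f_{n+1} = \pm a_n e_n$, so $\sigma_n = a_n$.  It remains to see that
  $\varepsilon_n$ is of order $n^{-5/2}$.

  Upper bound: truncate every coordinate towards $0$ to the grid $\delta\mathbb{Z}$ with
  $\delta$ of order $n^{-3}$.  The squared error is at most
  $\sum_i \min(\delta, |x_i|)^2 \le n \delta^2 + \delta n^{-2}$.  By the exponential Markov inequality,
  the number of integer sequences with $\sum_i (i+1)^2 |q_i| \le 1/\delta$ is at most
  $e^{s/\delta} \prod_i (1 + 2 / (s (i+1)^2))$, which by Euler's product for $\sinh$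
  and with $s$ of order $n^{-2}$ is at most $2^n$ for suitable constants.

  Lower bound: for $m = 2n$ the points $m^{-3} s$ with $s \in \{-1,1\}^m$ lie in $K$, and a ball of
  radius $\sqrt m / (2 m^3)$ contains at most $2^m e^{-3m/8}$ of them, which is less than $2^{m-n}$.
\<close>

section \<open>Exponential moment inequalities and counting estimates\<close>

text \<open>The power series are compared term by term, using
  \<open>2 ^ k * fact k \<le> fact (2 * k)\<close>. This is the sub-Gaussian bound for a random
  sign.\<close>

lemma cosh_le_exp_half_square: "cosh x \<le> exp (x\<^sup>2 / 2)" for x :: real
proof -
  have "(\<lambda>n. if even n then x ^ n /\<^sub>R fact n else 0) sums cosh x"
    by (rule cosh_converges)
  then have "(\<lambda>k. (if even (2*k) then x ^ (2*k) /\<^sub>R fact (2*k) else 0)) sums cosh x"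
    by (subst sums_mono_reindex[of "\<lambda>k. 2*k"]) (auto simp: strict_mono_def)
  then have c: "(\<lambda>k. x ^ (2*k) /\<^sub>R fact (2*k)) sums cosh x" by simp
  have e: "(\<lambda>k. (x\<^sup>2 / 2) ^ k /\<^sub>R fact k) sums exp (x\<^sup>2 / 2)"
    by (rule exp_converges)
  have fact: "2 ^ k * fact k \<le> (fact (2 * k) :: real)" for k
  proof (induction k)
    case (Suc k)
    have "2 ^ Suc k * fact (Suc k) = (2 * real (Suc k)) * (2 ^ k * fact k)" by simp
    also have "\<dots> \<le> (2 * real (Suc k)) * (real (2 * k + 1) * fact (2 * k))"
      using Suc order_trans[OF Suc, of "real (2 * k + 1) * fact (2 * k)"]
      by (intro mult_left_mono) (auto simp: algebra_simps)
    also have "\<dots> = fact (2 * Suc k)" by (simp add: algebra_simps)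
    finally show ?case .
  qed simp
  show ?thesis
  proof (rule sums_le[OF _ c e])
    fix k
    have "x ^ (2*k) /\<^sub>R fact (2*k) = (x\<^sup>2) ^ k / fact (2*k)"
      unfolding power_mult[of x 2 k] real_scaleR_def divide_inverse by (rule mult.commute)
    also have "\<dots> \<le> (x\<^sup>2) ^ k / (2 ^ k * fact k)"
      by (rule divide_left_mono[OF fact]) simp_all
    also have "\<dots> = (x\<^sup>2 / 2) ^ k /\<^sub>R fact k"
      by (simp only: power_divide real_scaleR_def) (simp add: field_simps)
    finally show "x ^ (2*k) /\<^sub>R fact (2*k) \<le> (x\<^sup>2 / 2) ^ k /\<^sub>R fact k" .
  qed
qed

text \<open>Euler's sine product at the imaginary point \<open>\<i> * w\<close> has increasing
  partial products with limit \<open>sinh (pi * w) / (pi * w)\<close>, which is at most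
  \<open>exp (pi * w)\<close>. The bound is uniform in \<open>M\<close>.\<close>

lemma prod_one_plus_le_exp:
  fixes w :: real
  assumes "w > 0"
  shows "(\<Prod>i<M. 1 + (w / real (Suc i))\<^sup>2) \<le> exp (pi * w)"
proof -
  define P where "P n = (\<Prod>i<n. 1 + (w / real (Suc i))\<^sup>2)" for n
  have P: "(\<Prod>k=1..n. 1 - (\<i> * of_real w)\<^sup>2 / (of_nat k)\<^sup>2) = complex_of_real (P n)" for n
    unfolding P_def of_real_prod
    by (rule prod.reindex_bij_witness[of _ Suc "\<lambda>k. k - 1"])
      (auto simp: power_mult_distrib power_divide)
  have "(\<lambda>n. of_real pi * (\<i> * of_real w) * complex_of_real (P n))
          \<longlonglongrightarrow> sin (of_real pi * (\<i> * of_real w))"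
    using sin_product_formula_complex[of "\<i> * of_real w"] unfolding P .
  also have "sin (of_real pi * (\<i> * of_real w)) = \<i> * of_real (sinh (pi * w))"
    using sinh_real[of "pi * w"]
    by (simp add: mult_ac sinh_field_def exp_minus)
  finally have "(\<lambda>n. Im (of_real pi * (\<i> * of_real w) * complex_of_real (P n)))
          \<longlonglongrightarrow> Im (\<i> * of_real (sinh (pi * w)))" by (rule tendsto_Im)
  then have lim: "(\<lambda>n. pi * w * P n) \<longlonglongrightarrow> sinh (pi * w)" by simp
  have "incseq P"
  proof (rule incseq_SucI)
    fix n
    have "P n * 1 \<le> P n * (1 + (w / real (Suc n))\<^sup>2)"
      unfolding P_def by (intro mult_left_mono prod_nonneg) auto
    then show "P n \<le> P (Suc n)" by (simp add: P_def)
  qed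
  then have "incseq (\<lambda>n. pi * w * P n)"
    using assms by (auto simp: incseq_def)
  from incseq_le[OF this lim] have "pi * w * P M \<le> sinh (pi * w)" .
  also have "\<dots> \<le> pi * w * exp (pi * w)"
  proof -
    define y where "y = pi * w"
    \<comment> \<open>Rearranged, this is \<open>sinh y \<le> y * exp y\<close>.\<close>
    have "exp y * (1 - 2 * y) \<le> exp y * exp (- 2 * y)"
      using exp_ge_add_one_self[of "- 2 * y"] by (intro mult_left_mono) auto
    also have "\<dots> = exp (- y)" by (simp flip: exp_add)
    finally show ?thesis unfolding y_def[symmetric] by (simp add: sinh_field_def algebra_simps)
  qed
  finally show ?thesis using assms by (simp add: P_def)
qed

text \<open>Expanding the square shows that a sign vector this close to \<open>y\<close> has inner
  product at least \<open>3 * m / 8 + Y / 2\<close> with \<open>y\<close>. The sum over all signs of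
  the exponential of that inner product factorizes into \<open>2 * cosh (y i)\<close>; its bound
  \<open>2 ^ m * exp (Y / 2)\<close> cancels the dependence on the centre.\<close>

lemma card_signs_near_le:
  fixes y :: "nat \<Rightarrow> real"
  shows "real (card {s \<in> {..<m} \<rightarrow>\<^sub>E {-1, 1}. (\<Sum>i<m. (s i - y i)\<^sup>2) \<le> m / 4})
    \<le> 2 ^ m * exp (- (3 * real m / 8))"
    (is "real (card ?G) \<le> _")
proof -
  let ?P = "{..<m} \<rightarrow>\<^sub>E {-1, 1::real}"
  define Y where "Y = (\<Sum>i<m. (y i)\<^sup>2)"
  have fin: "finite ?P" by (intro finite_PiE) auto
  have "real (card ?G) * exp (3 * real m / 8 + Y / 2) = (\<Sum>s\<in>?G. exp (3 * real m / 8 + Y / 2))" by simp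
  also have "\<dots> \<le> (\<Sum>s\<in>?G. exp (\<Sum>i<m. y i * s i))"
  proof (intro sum_mono)
    fix s assume s: "s \<in> ?G"
    have "(s i)\<^sup>2 = 1" if "i < m" for i
    proof -
      have "s i \<in> {-1, 1}" using s that by (auto simp: PiE_iff)
      then show ?thesis by auto
    qed
    then have "(\<Sum>i<m. (s i - y i)\<^sup>2) = (\<Sum>i<m. 1 + (y i)\<^sup>2 - 2 * (y i * s i))"
      by (intro sum.cong) (auto simp: power2_diff)
    also have "\<dots> = m + Y - 2 * (\<Sum>i<m. y i * s i)"
      by (simp add: Y_def sum.distrib sum_subtractf sum_distrib_left)
    finally show "exp (3 * real m / 8 + Y / 2) \<le> exp (\<Sum>i<m. y i * s i)"
      using s by simp
  qed
  also have "\<dots> \<le> (\<Sum>s\<in>?P. exp (\<Sum>i<m. y i * s i))"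
    using fin by (intro sum_mono2) auto
  also have "\<dots> = (\<Sum>s\<in>?P. \<Prod>i<m. exp (y i * s i))"
    by (simp add: exp_sum)
  also have "\<dots> = (\<Prod>i<m. \<Sum>t\<in>{-1, 1}. exp (y i * t))"
    by (subst prod_sum_PiE) auto
  also have "\<dots> = (\<Prod>i<m. 2 * cosh (y i))"
    by (intro prod.cong) (auto simp: cosh_field_def)
  also have "\<dots> \<le> (\<Prod>i<m. 2 * exp ((y i)\<^sup>2 / 2))"
    by (intro prod_mono) (auto intro: cosh_le_exp_half_square)
  also have "\<dots> = 2 ^ m * exp (Y / 2)"
    by (simp add: prod.distrib Y_def sum_divide_distrib flip: exp_sum)
  finally have "(real (card ?G) * exp (3 * real m / 8)) * exp (Y / 2) \<le> 2 ^ m * exp (Y / 2)"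
    by (simp add: exp_add mult.assoc)
  then show ?thesis by (simp add: exp_minus field_simps)
qed

text \<open>Besides the central term 1 there are two equal geometric sums, each at most
  \<open>1 / (exp x - 1) \<le> 1 / x\<close>.\<close>

lemma sum_exp_abs_le:
  fixes x :: real
  assumes "x > 0"
  shows "(\<Sum>k=-int B..int B. exp (- x * \<bar>real_of_int k\<bar>)) \<le> 1 + 2 / x"
proof -
  have eq: "(\<Sum>k=-int B..int B. exp (- x * \<bar>real_of_int k\<bar>)) = 1 + 2 * (\<Sum>j<B. exp (-x) ^ Suc j)" for B
  proof (induction B)
    case (Suc B)
    have "{-int (Suc B)..int (Suc B)} = insert (- int (Suc B)) (insert (int (Suc B)) {-int B..int B})"
      by auto
    with Suc show ?case by (simp add: algebra_simps flip: exp_add exp_of_nat_mult)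
  qed simp
  let ?v = "exp (-x)"
  have v: "?v < 1" "?v > 0" using assms by auto
  have "(\<Sum>j<B. ?v ^ Suc j) = ?v * (\<Sum>j<B. ?v ^ j)" by (simp add: sum_distrib_left)
  also have "\<dots> = ?v * ((1 - ?v ^ B) / (1 - ?v))"
    using v by (simp add: sum_gp_strict)
  also have "\<dots> \<le> ?v * (1 / (1 - ?v))"
    using v by (intro mult_left_mono divide_right_mono) auto
  also have "\<dots> = 1 / (exp x - 1)"
    using assms by (simp add: exp_minus field_simps)
  also have "\<dots> \<le> 1 / x"
    using assms exp_ge_add_one_self[of x] by (intro divide_left_mono mult_pos_pos) linarith+
  finally show ?thesis unfolding eq by simp
qed

text \<open>Exponential Markov inequality: every counted \<open>q\<close> has weight at least
  \<open>exp (- s * N)\<close>, and the total weight of the box factorizes over the coordinates. The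
  bound is independent of \<open>M\<close> and \<open>B\<close>, and \<open>s\<close> stays free for
  later optimization.\<close>

lemma card_int_cross_polytope_le:
  fixes N s :: real
  assumes "s > 0"
  shows "real (card {q \<in> {..<M} \<rightarrow>\<^sub>E {-int B..int B}. (\<Sum>i<M. (real (Suc i))\<^sup>2 * \<bar>real_of_int (q i)\<bar>) \<le> N})
    \<le> exp (s * N + pi * sqrt (2 / s))"
    (is "real (card ?Q) \<le> _")
proof -
  let ?P = "{..<M} \<rightarrow>\<^sub>E {-int B..int B}"
  let ?w = "\<lambda>i. (real (Suc i))\<^sup>2"
  have fin: "finite ?P" by (intro finite_PiE) auto
  have "real (card ?Q) * exp (- s * N) = (\<Sum>q\<in>?Q. exp (- s * N))" by simp
  also have "\<dots> \<le> (\<Sum>q\<in>?Q. exp (- s * (\<Sum>i<M. ?w i * \<bar>real_of_int (q i)\<bar>)))"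
    using assms by (intro sum_mono) auto
  also have "\<dots> \<le> (\<Sum>q\<in>?P. exp (- s * (\<Sum>i<M. ?w i * \<bar>real_of_int (q i)\<bar>)))"
    using fin by (intro sum_mono2) auto
  also have "\<dots> = (\<Sum>q\<in>?P. \<Prod>i<M. exp (- (s * ?w i) * \<bar>real_of_int (q i)\<bar>))"
    by (simp add: exp_sum sum_distrib_left sum_negf mult.assoc flip: sum_negf)
  also have "\<dots> = (\<Prod>i<M. \<Sum>k=-int B..int B. exp (- (s * ?w i) * \<bar>real_of_int k\<bar>))"
    by (subst prod_sum_PiE) auto
  also have "\<dots> \<le> (\<Prod>i<M. 1 + 2 / (s * ?w i))"
    using assms by (intro prod_mono conjI sum_exp_abs_le sum_nonneg) auto
  \<comment> \<open>The summand is written as a square to match the Euler product with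
    \<open>w = sqrt (2 / s)\<close>.\<close>
  also have "\<dots> = (\<Prod>i<M. 1 + (sqrt (2 / s) / real (Suc i))\<^sup>2)"
    using assms by (intro prod.cong) (auto simp: power_divide)
  also have "\<dots> \<le> exp (pi * sqrt (2 / s))"
    using assms by (intro prod_one_plus_le_exp) auto
  finally show ?thesis by (simp add: exp_add exp_minus field_simps)
qed

text \<open>Rounding goes towards 0, not to the nearest grid point: absolute values then never grow,
  so the weighted l1 constraint survives, and the error is also at most
  \<open>\<bar>x\<bar>\<close>, which controls the tail of small coordinates.\<close>

lemma truncate_to_grid:
  fixes x \<delta> :: real
  assumes "\<delta> > 0"
  obtains k :: int where "\<bar>x - \<delta> * k\<bar> \<le> \<delta>" "\<bar>x - \<delta> * k\<bar> \<le> \<bar>x\<bar>" "\<delta> * \<bar>k\<bar> \<le> \<bar>x\<bar>"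
proof -
  define j where "j = \<lfloor>\<bar>x\<bar> / \<delta>\<rfloor>"
  have "real_of_int j \<le> \<bar>x\<bar> / \<delta>" "\<bar>x\<bar> / \<delta> < real_of_int j + 1"
    unfolding j_def by linarith+
  then have j: "\<delta> * real_of_int j \<le> \<bar>x\<bar>" "\<bar>x\<bar> < \<delta> * j + \<delta>"
    using assms by (auto simp: field_simps)
  have j0: "0 \<le> \<delta> * real_of_int j" using assms by (simp add: j_def)
  then have "\<delta> * \<bar>real_of_int j\<bar> = \<delta> * j" using assms by (simp add: zero_le_mult_iff)
  with j j0 show ?thesis
    using that[of j] that[of "- j"] by (cases "x \<ge> 0") simp_all
qed

section \<open>Coordinate subspaces of l2\<close>

text \<open>Applied to \<open>Rep_l2 x\<close> this is the orthogonal projection of \<open>x\<close>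
  onto the first \<open>n\<close> coordinates; it also builds finitely supported points from raw
  coordinate data.\<close>

lift_definition l2_vec :: "nat \<Rightarrow> (nat \<Rightarrow> real) \<Rightarrow> l2" is "\<lambda>n x i. if i < n then x i else 0"
proof -
  fix n and x :: "nat \<Rightarrow> real"
  show "summable (\<lambda>i. (if i < n then x i else 0)\<^sup>2)"
    by (rule summable_finite[of "{..<n}"]) auto
qed

lemma l2_summable: "summable (\<lambda>i. (Rep_l2 x i)\<^sup>2)"
  using Rep_l2[of x] by simp

lemma l2_norm_power2_le_iff:
  "(norm x)\<^sup>2 \<le> b \<longleftrightarrow> (\<forall>N. (\<Sum>i<N. (Rep_l2 x i)\<^sup>2) \<le> b)"
proof
  show "\<forall>N. (\<Sum>i<N. (Rep_l2 x i)\<^sup>2) \<le> b" if "(norm x)\<^sup>2 \<le> b"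
    using that l2_sum_le_norm[of _ x] by (meson finite_lessThan order_trans)
  show "(norm x)\<^sup>2 \<le> b" if "\<forall>N. (\<Sum>i<N. (Rep_l2 x i)\<^sup>2) \<le> b"
    unfolding l2_norm_power2 using that by (intro suminf_le_const l2_summable) auto
qed

lemma l2_coord_le_norm: "\<bar>Rep_l2 x i\<bar> \<le> norm x"
  using l2_sum_le_norm[of "{i}" x] by (simp flip: abs_le_square_iff)

lemma tendsto_Rep_l2:
  assumes "X \<longlonglongrightarrow> x"
  shows "(\<lambda>n. Rep_l2 (X n) i) \<longlonglongrightarrow> Rep_l2 x i"
proof (rule LIMSEQ_I)
  fix e :: real assume "e > 0"
  with assms obtain M where "\<And>n. n \<ge> M \<Longrightarrow> norm (X n - x) < e"
    by (meson LIMSEQ_D)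
  then show "\<exists>M. \<forall>n\<ge>M. norm (Rep_l2 (X n) i - Rep_l2 x i) < e"
    using l2_coord_le_norm[of "X _ - x" i] by (metis le_less_trans minus_l2.rep_eq real_norm_def)
qed

definition coord_space :: "nat \<Rightarrow> l2 set"
  where "coord_space n = {y. \<forall>i\<ge>n. Rep_l2 y i = 0}"

text \<open>The projection is a nearest point: for \<open>y\<close> in the subspace,
  \<open>x - y\<close> agrees with \<open>x\<close> in all coordinates from \<open>n\<close> on, so
  the squares can be compared termwise.\<close>

lemma infdist_coord_space:
  "infdist x (coord_space n) = norm (x - l2_vec n (Rep_l2 x))"
proof (rule antisym)
  have mem: "l2_vec n (Rep_l2 x) \<in> coord_space n"
    by (simp add: coord_space_def l2_vec.rep_eq)
  then show "infdist x (coord_space n) \<le> norm (x - l2_vec n (Rep_l2 x))"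
    using infdist_le[OF mem] by (simp add: dist_norm)
  have "norm (x - l2_vec n (Rep_l2 x)) \<le> dist x y" if y: "y \<in> coord_space n" for y
  proof -
    have "(norm (x - l2_vec n (Rep_l2 x)))\<^sup>2 \<le> (norm (x - y))\<^sup>2"
      unfolding l2_norm_power2 using y
      by (intro suminf_le l2_summable) (auto simp: minus_l2.rep_eq l2_vec.rep_eq coord_space_def)
    then show ?thesis by (simp add: dist_norm)
  qed
  then show "norm (x - l2_vec n (Rep_l2 x)) \<le> infdist x (coord_space n)"
    unfolding infdist_def using mem by (auto intro!: cINF_greatest)
qed

text \<open>Modulo \<open>coord_space n\<close> the vector \<open>f\<close> is a nonzero multiple of
  the coordinate vector of index \<open>n\<close>, so subtracting
  \<open>Rep_l2 y n / Rep_l2 f n\<close> times \<open>f\<close> removes that coordinate of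
  \<open>y\<close>.\<close>

lemma span_insert_coord_space:
  assumes "span S = coord_space n" "f \<in> coord_space (Suc n)" "Rep_l2 f n \<noteq> 0"
  shows "span (insert f S) = coord_space (Suc n)"
proof -
  have "(\<exists>k. \<forall>i\<ge>n. Rep_l2 y i = k * Rep_l2 f i) \<longleftrightarrow> (\<forall>i\<ge>Suc n. Rep_l2 y i = 0)" for y
  proof
    assume "\<exists>k. \<forall>i\<ge>n. Rep_l2 y i = k * Rep_l2 f i"
    then show "\<forall>i\<ge>Suc n. Rep_l2 y i = 0" using assms(2) by (auto simp: coord_space_def)
  next
    assume y: "\<forall>i\<ge>Suc n. Rep_l2 y i = 0"
    have "Rep_l2 y i = Rep_l2 y n / Rep_l2 f n * Rep_l2 f i" if "i \<ge> n" for i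
      using y assms(2,3) that by (cases "i = n") (auto simp: coord_space_def)
    then show "\<exists>k. \<forall>i\<ge>n. Rep_l2 y i = k * Rep_l2 f i" by blast
  qed
  then show ?thesis
    unfolding span_insert assms(1)
    by (auto simp: coord_space_def minus_l2.rep_eq scaleR_l2.rep_eq)
qed

section \<open>The weighted cross-polytope\<close>

text \<open>Bounding all partial sums of nonnegative terms expresses both convergence and the bound
  on the series. Each condition involves finitely many coordinates, so it passes to limits.\<close>

definition cross_polytope :: "l2 set"
  where "cross_polytope = {x. \<forall>N. (\<Sum>i<N. (real (Suc i))\<^sup>2 * \<bar>Rep_l2 x i\<bar>) \<le> 1}"

lemma cross_polytopeD:
  "x \<in> cross_polytope \<Longrightarrow> (\<Sum>i<N. (real (Suc i))\<^sup>2 * \<bar>Rep_l2 x i\<bar>) \<le> 1"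
  unfolding cross_polytope_def by blast

lemma cross_polytope_coord_le:
  assumes "x \<in> cross_polytope"
  shows "(real (Suc i))\<^sup>2 * \<bar>Rep_l2 x i\<bar> \<le> 1"
proof -
  have "(real (Suc i))\<^sup>2 * \<bar>Rep_l2 x i\<bar> \<le> (\<Sum>j<Suc i. (real (Suc j))\<^sup>2 * \<bar>Rep_l2 x j\<bar>)"
    by (rule member_le_sum) auto
  also have "\<dots> \<le> 1" using assms by (rule cross_polytopeD)
  finally show ?thesis .
qed

lemma uminus_in_cross_polytope: "x \<in> cross_polytope \<Longrightarrow> - x \<in> cross_polytope"
  by (simp add: cross_polytope_def uminus_l2.rep_eq)

lemma convex_cross_polytope: "convex cross_polytope"
proof (rule convexI)
  fix x y :: l2 and u v :: real
  assume xy: "x \<in> cross_polytope" "y \<in> cross_polytope" and uv: "0 \<le> u" "0 \<le> v" "u + v = 1"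
  have "(\<Sum>i<N. (real (Suc i))\<^sup>2 * \<bar>Rep_l2 (u *\<^sub>R x + v *\<^sub>R y) i\<bar>) \<le> 1" for N
  proof -
    have "(\<Sum>i<N. (real (Suc i))\<^sup>2 * \<bar>Rep_l2 (u *\<^sub>R x + v *\<^sub>R y) i\<bar>)
        \<le> (\<Sum>i<N. (real (Suc i))\<^sup>2 * (u * \<bar>Rep_l2 x i\<bar> + v * \<bar>Rep_l2 y i\<bar>))"
    proof (intro sum_mono mult_left_mono)
      show "\<bar>Rep_l2 (u *\<^sub>R x + v *\<^sub>R y) i\<bar> \<le> u * \<bar>Rep_l2 x i\<bar> + v * \<bar>Rep_l2 y i\<bar>" for i
        using abs_triangle_ineq[of "u * Rep_l2 x i" "v * Rep_l2 y i"] uv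
        by (simp add: plus_l2.rep_eq scaleR_l2.rep_eq abs_mult)
    qed simp
    also have "\<dots> = u * (\<Sum>i<N. (real (Suc i))\<^sup>2 * \<bar>Rep_l2 x i\<bar>)
                  + v * (\<Sum>i<N. (real (Suc i))\<^sup>2 * \<bar>Rep_l2 y i\<bar>)"
      by (simp add: sum_distrib_left sum.distrib ring_distribs mult.left_commute)
    also have "\<dots> \<le> u * 1 + v * 1"
      using xy uv by (intro add_mono mult_left_mono) (auto simp: cross_polytope_def)
    finally show ?thesis using uv by simp
  qed
  then show "u *\<^sub>R x + v *\<^sub>R y \<in> cross_polytope" by (simp add: cross_polytope_def)
qed

lemma closed_cross_polytope: "closed cross_polytope"
  unfolding closed_sequential_limits
proof (intro allI impI, elim conjE)
  fix X x assume X: "\<forall>n. X n \<in> cross_polytope" "X \<longlonglongrightarrow> x"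
  have "(\<Sum>i<N. (real (Suc i))\<^sup>2 * \<bar>Rep_l2 x i\<bar>) \<le> 1" for N
  proof (rule LIMSEQ_le_const2)
    show "(\<lambda>n. \<Sum>i<N. (real (Suc i))\<^sup>2 * \<bar>Rep_l2 (X n) i\<bar>)
            \<longlonglongrightarrow> (\<Sum>i<N. (real (Suc i))\<^sup>2 * \<bar>Rep_l2 x i\<bar>)"
      by (intro tendsto_intros tendsto_Rep_l2 X)
  qed (use X in \<open>auto simp: cross_polytope_def\<close>)
  then show "x \<in> cross_polytope" by (simp add: cross_polytope_def)
qed

section \<open>The greedy algorithm on the cross-polytope\<close>

text \<open>
  The bracketed term is nonnegative, and it is positive if \<open>j \<noteq> n\<close> and the \<open>j\<close>-th coordinate of
  \<open>x\<close> is nonzero; this forces the choice of the greedy algorithm.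
\<close>

lemma dist_coord_space_cross_polytope:
  assumes x: "x \<in> cross_polytope" and a: "a = 1 / (real (Suc n))\<^sup>2"
  shows "(norm (x - l2_vec n (Rep_l2 x)))\<^sup>2
    + (a\<^sup>2 * ((real (Suc j))\<^sup>2 * \<bar>Rep_l2 x j\<bar>) - (if j < n then 0 else (Rep_l2 x j)\<^sup>2)) \<le> a\<^sup>2"
proof -
  define u where "u i = (if i < n then 0 else (Rep_l2 x i)\<^sup>2)" for i
  define v where "v i = a\<^sup>2 * ((real (Suc i))\<^sup>2 * \<bar>Rep_l2 x i\<bar>)" for i
  have uv: "u i \<le> v i" for i
  proof (cases "i < n")
    case False
    let ?w = "(real (Suc i))\<^sup>2"
    \<comment> \<open>For \<open>i \<ge> n\<close> the weight is at least \<open>1 / a\<close>,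
      hence \<open>\<bar>Rep_l2 x i\<bar> \<le> a\<close>; trading one factor of the square for
      \<open>a\<close> and then inserting \<open>a * ?w \<ge> 1\<close> gives
      \<open>u i \<le> v i\<close>.\<close>
    have aw: "1 \<le> a * ?w" using False by (simp add: a field_simps power_mono)
    have a0: "a > 0" by (simp add: a)
    have "\<bar>Rep_l2 x i\<bar> * 1 \<le> \<bar>Rep_l2 x i\<bar> * (a * ?w)" using aw by (intro mult_left_mono) auto
    also have "\<dots> \<le> a" 
      using mult_left_mono[OF cross_polytope_coord_le[OF x, of i], of a] a0 by (simp add: mult_ac)
    finally have xa: "\<bar>Rep_l2 x i\<bar> \<le> a" by simp
    have "u i = \<bar>Rep_l2 x i\<bar> * \<bar>Rep_l2 x i\<bar>" using False by (simp add: u_def power2_eq_square)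
    also have "\<dots> \<le> (a * (a * ?w)) * \<bar>Rep_l2 x i\<bar>"
      using mult_mono[OF xa aw] a0 by (intro mult_right_mono) auto
    finally show ?thesis by (simp add: v_def power2_eq_square mult_ac)
  qed (simp add: u_def v_def)
  have "(norm (x - l2_vec n (Rep_l2 x)))\<^sup>2 \<le> a\<^sup>2 - (v j - u j)"
    unfolding l2_norm_power2_le_iff
  proof
    fix N
    have "(\<Sum>i<N. (Rep_l2 (x - l2_vec n (Rep_l2 x)) i)\<^sup>2) + (v j - u j)
        = (\<Sum>i<N. u i) + (v j - u j)"
      by (intro arg_cong2[of _ _ _ _ "(+)"] sum.cong) (auto simp: u_def minus_l2.rep_eq l2_vec.rep_eq)
    \<comment> \<open>The range is enlarged to contain \<open>j\<close>, so that
      \<open>v j - u j\<close> becomes one of the nonnegative terms of the second sum.\<close>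
    also have "\<dots> \<le> (\<Sum>i<N + Suc j. u i) + (\<Sum>i<N + Suc j. v i - u i)"
      using uv by (intro add_mono sum_mono2 member_le_sum) (auto simp: u_def)
    also have "\<dots> = a\<^sup>2 * (\<Sum>i<N + Suc j. (real (Suc i))\<^sup>2 * \<bar>Rep_l2 x i\<bar>)"
      by (simp only: sum_subtractf v_def sum_distrib_left)
    also have "\<dots> \<le> a\<^sup>2 * 1"
      by (intro mult_left_mono cross_polytopeD[OF x]) simp
    finally show "(\<Sum>i<N. (Rep_l2 (x - l2_vec n (Rep_l2 x)) i)\<^sup>2) \<le> a\<^sup>2 - (v j - u j)" by simp
  qed
  then show ?thesis unfolding u_def v_def by linarith
qed

text \<open>This is the preceding inequality at \<open>j = n\<close>, where the bracket is
  nonnegative because \<open>\<bar>Rep_l2 x n\<bar> \<le> a\<close>.\<close>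

lemma infdist_cross_polytope_le:
  assumes "x \<in> cross_polytope"
  shows "infdist x (coord_space n) \<le> 1 / (real (Suc n))\<^sup>2"
proof -
  define a where "a = 1 / (real (Suc n))\<^sup>2"
  have a0: "a > 0" by (simp add: a_def)
  have xa: "\<bar>Rep_l2 x n\<bar> \<le> a"
    using cross_polytope_coord_le[OF assms, of n] by (simp add: a_def field_simps)
  have "(Rep_l2 x n)\<^sup>2 = \<bar>Rep_l2 x n\<bar> * \<bar>Rep_l2 x n\<bar>" by (simp add: power2_eq_square)
  also have "\<dots> \<le> a * \<bar>Rep_l2 x n\<bar>" using xa by (intro mult_right_mono) auto
  also have "\<dots> = a\<^sup>2 * ((real (Suc n))\<^sup>2 * \<bar>Rep_l2 x n\<bar>)"
    by (simp add: a_def power2_eq_square)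
  finally have "(norm (x - l2_vec n (Rep_l2 x)))\<^sup>2 \<le> a\<^sup>2"
    using dist_coord_space_cross_polytope[OF assms a_def, of n] by simp
  then show ?thesis
    unfolding infdist_coord_space a_def[symmetric] by (rule power2_le_imp_le) (use a0 in simp)
qed

text \<open>This is the equality case: once the distance exhausts the bound, no bracket can be
  positive, so only the coordinate of index \<open>n\<close> can be nonzero. If it vanished too, the
  distance would be 0.\<close>

lemma cross_polytope_extremal:
  assumes x: "x \<in> cross_polytope" and "1 / (real (Suc n))\<^sup>2 \<le> infdist x (coord_space n)"
  shows "x \<in> coord_space (Suc n)" "Rep_l2 x n \<noteq> 0"
proof -
  define a where "a = 1 / (real (Suc n))\<^sup>2"
  have a0: "a > 0" by (simp add: a_def)
  have "a\<^sup>2 \<le> (norm (x - l2_vec n (Rep_l2 x)))\<^sup>2"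
    using assms(2) a0 unfolding infdist_coord_space a_def[symmetric] by (intro power_mono) auto
  then have le: "a\<^sup>2 * ((real (Suc j))\<^sup>2 * \<bar>Rep_l2 x j\<bar>) \<le> (if j < n then 0 else (Rep_l2 x j)\<^sup>2)" for j
    using dist_coord_space_cross_polytope[OF x a_def, of j] by linarith
  have zero: "Rep_l2 x j = 0" if "j \<noteq> n" for j
  proof (rule ccontr)
    assume nz: "Rep_l2 x j \<noteq> 0"
    let ?w = "(real (Suc j))\<^sup>2"
    have pos: "a\<^sup>2 * (?w * \<bar>Rep_l2 x j\<bar>) > 0" using nz a0 by simp
    show False
    proof (cases "j < n")
      case False
      then have "(real (Suc n))\<^sup>2 < ?w" using that by (intro power_strict_mono) auto
      then have aw: "1 < a * ?w" by (simp add: a_def field_simps)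
      \<comment> \<open>Extremality gives
        \<open>\<bar>Rep_l2 x j\<bar> \<ge> a\<^sup>2 * ?w\<close>, whereas membership gives
        \<open>?w * \<bar>Rep_l2 x j\<bar> \<le> 1\<close>; together they contradict
        \<open>a * ?w > 1\<close>.\<close>
      have "a * ?w * (a * ?w) \<le> ?w * \<bar>Rep_l2 x j\<bar>"
      proof -
        have "(a\<^sup>2 * ?w) * \<bar>Rep_l2 x j\<bar> \<le> \<bar>Rep_l2 x j\<bar> * \<bar>Rep_l2 x j\<bar>"
          using le[of j] False by (simp add: power2_eq_square mult_ac)
        then have "a\<^sup>2 * ?w \<le> \<bar>Rep_l2 x j\<bar>" using nz by (simp only: mult_le_cancel_right)
        then have "?w * (a\<^sup>2 * ?w) \<le> ?w * \<bar>Rep_l2 x j\<bar>" by (intro mult_left_mono) auto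
        then show ?thesis by (simp add: power2_eq_square mult_ac)
      qed
      then have "a * ?w * (a * ?w) \<le> 1" using cross_polytope_coord_le[OF x, of j] by linarith
      moreover have "1 * 1 < a * ?w * (a * ?w)" using aw by (intro mult_strict_mono) auto
      ultimately show False by simp
    qed (use le[of j] pos in simp)
  qed
  then show "x \<in> coord_space (Suc n)" by (simp add: coord_space_def)
  show "Rep_l2 x n \<noteq> 0"
  proof
    assume "Rep_l2 x n = 0"
    with zero have "Rep_l2 x j = 0" for j by metis
    then have "x \<in> coord_space n" by (simp add: coord_space_def)
    with assms(2) show False by simp
  qed
qed

text \<open>The vertex on axis \<open>n\<close> attains the upper bound and serves as the competitor
  in the greedy choice.\<close>

lemma cross_polytope_vertex:
  obtains x where "x \<in> cross_polytope" "infdist x (coord_space n) = 1 / (real (Suc n))\<^sup>2"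
proof
  let ?a = "1 / (real (Suc n))\<^sup>2"
  let ?x = "l2_vec (Suc n) (\<lambda>i. if i = n then ?a else 0)"
  have R: "Rep_l2 ?x i = (if i = n then ?a else 0)" for i by (simp add: l2_vec.rep_eq)
  have "(\<Sum>i<N. (real (Suc i))\<^sup>2 * \<bar>Rep_l2 ?x i\<bar>) = (\<Sum>i<N. if i = n then 1 else 0)" for N
    unfolding R by (intro sum.cong) auto
  then show x: "?x \<in> cross_polytope" by (simp add: cross_polytope_def)
  have "?a \<le> norm (?x - l2_vec n (Rep_l2 ?x))"
    using l2_coord_le_norm[of "?x - l2_vec n (Rep_l2 ?x)" n]
    by (simp add: minus_l2.rep_eq R) (simp add: l2_vec.rep_eq)
  then show "infdist ?x (coord_space n) = ?a"
    using infdist_cross_polytope_le[OF x, of n] unfolding infdist_coord_space by simp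
qed

text \<open>Whatever the tie-breaking, the maximizer in step \<open>Suc n\<close> is at least as far
  away as the vertex, hence extremal, and adds exactly the coordinate of index \<open>n\<close>
  (coordinates count from 0, steps from 1).\<close>

lemma greedy_space_cross_polytope:
  assumes "greedy_run cross_polytope f"
  shows "greedy_space f n = coord_space n"
proof (induction n)
  case 0
  have "(\<forall>i. Rep_l2 y i = 0) \<longleftrightarrow> y = 0" for y
    using Rep_l2_inject[of y 0] by (simp add: fun_eq_iff zero_l2.rep_eq)
  then show ?case by (simp add: greedy_space_def coord_space_def)
next
  case (Suc n)
  obtain v where v: "v \<in> cross_polytope" "infdist v (coord_space n) = 1 / (real (Suc n))\<^sup>2"
    by (rule cross_polytope_vertex)
  have "is_arg_max (\<lambda>x. infdist x (greedy_space f n)) (\<lambda>x. x \<in> cross_polytope) (f (Suc n))"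
    using assms[unfolded greedy_run_def, rule_format, of "Suc n"] by simp
  then have f: "f (Suc n) \<in> cross_polytope" "infdist v (coord_space n) \<le> infdist (f (Suc n)) (coord_space n)"
    using v(1) Suc by (auto simp: is_arg_max_def not_less)
  have "{1..Suc n} = insert (Suc n) {1..n}" by auto
  then show ?case
    using span_insert_coord_space[of "f ` {1..n}" n "f (Suc n)"] Suc
      cross_polytope_extremal[OF f(1), of n] f(2) v(2)
    by (simp add: greedy_space_def)
qed

lemma greedy_error_cross_polytope:
  assumes "greedy_run cross_polytope f"
  shows "greedy_error cross_polytope f n = 1 / (real (Suc n))\<^sup>2"
proof -
  obtain v where v: "v \<in> cross_polytope" "infdist v (coord_space n) = 1 / (real (Suc n))\<^sup>2"
    by (rule cross_polytope_vertex)
  show ?thesis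
    unfolding greedy_error_def greedy_space_cross_polytope[OF assms]
  proof (rule cSup_eq_maximum)
    show "1 / (real (Suc n))\<^sup>2 \<in> (\<lambda>x. infdist x (coord_space n)) ` cross_polytope"
      using v by (metis image_eqI)
  qed (use infdist_cross_polytope_le in auto)
qed

section \<open>Entropy numbers by counting lattice points\<close>

lemma sum_if_less_le:
  fixes c :: real
  assumes "c \<ge> 0"
  shows "(\<Sum>i<N. if i < m then c else 0) \<le> real m * c"
proof -
  have "(\<Sum>i<N. if i < m then c else 0) = (\<Sum>i\<in>{..<N} \<inter> {..<m}. c)"
    by (simp only: sum.inter_restrict finite_lessThan lessThan_iff)
  also have "\<dots> = real (card ({..<N} \<inter> {..<m})) * c" by simp
  also have "\<dots> \<le> real m * c"
    using card_mono[of "{..<m}" "{..<N} \<inter> {..<m}"] assms by (intro mult_right_mono) auto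
  finally show ?thesis .
qed

text \<open>Pigeonhole on the \<open>2 ^ m\<close> scaled sign vectors: smaller balls would each
  contain at most \<open>2 ^ m * exp (- (3 * m / 8))\<close> of them, too few for
  \<open>2 ^ n\<close> balls.\<close>

lemma cross_polytope_cover_radius_ge:
  fixes z :: "nat \<Rightarrow> l2"
  assumes n: "n \<ge> 1" and \<epsilon>: "0 < \<epsilon>"
    and cover: "cross_polytope \<subseteq> (\<Union>j<2 ^ n. cball (z j) \<epsilon>)"
  shows "sqrt (2 * n) / (2 * (2 * real n) ^ 3) \<le> \<epsilon>"
proof (rule ccontr)
  assume neg: "\<not> ?thesis"
  define m where "m = 2 * n"
  \<comment> \<open>With this scale the weighted sum is at most
    \<open>m * (m\<^sup>2 * t) = 1\<close>, so the scaled sign vectors lie in the set.\<close>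
  define t where "t = 1 / real m ^ 3"
  have m0: "real m > 0" using n by (simp add: m_def)
  have t0: "t > 0" using m0 by (simp add: t_def)
  have "\<epsilon> \<le> t * sqrt m / 2" using neg by (simp add: t_def m_def)
  then have "\<epsilon>\<^sup>2 \<le> (t * sqrt m / 2)\<^sup>2" using \<epsilon> by (intro power_mono) auto
  then have \<epsilon>t: "\<epsilon>\<^sup>2 \<le> t\<^sup>2 * (m / 4)" by (simp add: power_mult_distrib power_divide)
  let ?P = "{..<m} \<rightarrow>\<^sub>E {-1, 1::real}"
  \<comment> \<open>Dividing by \<open>t\<close> turns the balls into balls of squared radius at
    most \<open>m / 4\<close>, as the counting lemma requires.\<close>
  let ?y = "\<lambda>j i. Rep_l2 (z j) i / t"
  let ?G = "\<lambda>j. {s \<in> ?P. (\<Sum>i<m. (s i - ?y j i)\<^sup>2) \<le> m / 4}"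
  have "?P \<subseteq> (\<Union>j<2 ^ n. ?G j)"
  proof
    fix s assume s: "s \<in> ?P"
    define p where "p = l2_vec m (\<lambda>i. t * s i)"
    have Rep: "Rep_l2 p i = (if i < m then t * s i else 0)" for i
      by (simp add: p_def l2_vec.rep_eq)
    have abs1: "\<bar>s i\<bar> = 1" if "i < m" for i
    proof -
      have "s i \<in> {-1, 1}" using s that by (auto simp: PiE_iff)
      then show ?thesis by auto
    qed
    have "p \<in> cross_polytope"
      unfolding cross_polytope_def
    proof (intro CollectI allI)
      fix N
      have "(\<Sum>i<N. (real (Suc i))\<^sup>2 * \<bar>Rep_l2 p i\<bar>) \<le> (\<Sum>i<N. if i < m then 1 / m else 0)"
      proof (rule sum_mono)
        fix i
        show "(real (Suc i))\<^sup>2 * \<bar>Rep_l2 p i\<bar> \<le> (if i < m then 1 / m else 0)"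
        proof (cases "i < m")
          case True
          then have "(real (Suc i))\<^sup>2 * t \<le> (real m)\<^sup>2 * t"
            using t0 by (intro mult_right_mono power_mono) auto
          also have "\<dots> = 1 / m" by (simp add: t_def power2_eq_square power3_eq_cube)
          finally show ?thesis using True t0 abs1[of i] by (simp add: Rep abs_mult)
        qed (simp add: Rep)
      qed
      also have "\<dots> \<le> real m * (1 / real m)" by (rule sum_if_less_le) simp
      also have "\<dots> = 1" using m0 by simp
      finally show "(\<Sum>i<N. (real (Suc i))\<^sup>2 * \<bar>Rep_l2 p i\<bar>) \<le> 1" .
    qed
    with cover obtain j where j: "j < 2 ^ n" "dist (z j) p \<le> \<epsilon>" by auto
    have "t\<^sup>2 * (\<Sum>i<m. (s i - ?y j i)\<^sup>2) = (\<Sum>i<m. (Rep_l2 (p - z j) i)\<^sup>2)"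
      unfolding sum_distrib_left
    proof (rule sum.cong)
      fix i assume "i \<in> {..<m}"
      then have "Rep_l2 (p - z j) i = t * (s i - ?y j i)"
        using t0 by (simp add: minus_l2.rep_eq Rep algebra_simps)
      then show "t\<^sup>2 * (s i - ?y j i)\<^sup>2 = (Rep_l2 (p - z j) i)\<^sup>2"
        by (simp only: power_mult_distrib)
    qed simp
    also have "\<dots> \<le> (norm (p - z j))\<^sup>2" by (rule l2_sum_le_norm) simp
    also have "\<dots> \<le> \<epsilon>\<^sup>2" using j(2) by (intro power_mono) (auto simp: dist_norm norm_minus_commute)
    also note \<epsilon>t
    finally have "(\<Sum>i<m. (s i - ?y j i)\<^sup>2) \<le> m / 4"
      using t0 by (simp only: mult_le_cancel_left_pos zero_less_power)
    with s j(1) show "s \<in> (\<Union>j<2 ^ n. ?G j)" by blast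
  qed
  moreover have "finite (?G j)" for j
    by (rule finite_subset[of _ ?P]) (auto intro!: finite_PiE)
  ultimately have "card ?P \<le> card (\<Union>j<(2::nat) ^ n. ?G j)"
    by (intro card_mono finite_UN_I) auto
  also have "\<dots> \<le> (\<Sum>j<(2::nat) ^ n. card (?G j))" by (rule card_UN_le) simp
  finally have "real (card ?P) \<le> real (\<Sum>j<(2::nat) ^ n. card (?G j))"
    by (simp only: of_nat_le_iff)
  also have "\<dots> = (\<Sum>j<(2::nat) ^ n. real (card (?G j)))" by (rule of_nat_sum)
  also have "\<dots> \<le> (\<Sum>j<(2::nat) ^ n. 2 ^ m * exp (- (3 * real m / 8)))"
    by (intro sum_mono card_signs_near_le)
  also have "\<dots> = 2 ^ m * (2 ^ n * exp (- (3 * real m / 8)))" by simp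
  also have "card ?P = 2 ^ m" by (simp add: card_PiE numeral_2_eq_2)
  finally have "2 ^ m * 1 \<le> (2::real) ^ m * (2 ^ n * exp (- (3 * real m / 8)))" by simp
  then have "1 \<le> (2::real) ^ n * exp (- (3 * real m / 8))"
    by (simp only: mult_le_cancel_left_pos zero_less_power zero_less_numeral)
  also have "(2::real) ^ n = exp (n * ln 2)" by (simp add: exp_of_nat_mult)
  also have "exp (n * ln 2) * exp (- (3 * real m / 8)) = exp (n * (ln 2 - 3 / 4))"
    by (simp add: m_def algebra_simps flip: exp_add)
  finally have "0 \<le> real n * (ln 2 - 3 / 4)" by simp
  \<comment> \<open>Since \<open>m = 2 * n\<close>, the total count is decided by
    \<open>ln 2 \<le> 25 / 36 < 3 / 4\<close>.\<close>
  then show False using n ln2_le_25_over_36 by (simp add: zero_le_mult_iff)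
qed

text \<open>Rounding towards 0 keeps the weighted constraint. The squared error is charged as
  \<open>\<delta>\<^sup>2\<close> to each of the first \<open>n\<close> coordinates and as
  \<open>\<delta> * \<bar>Rep_l2 x i\<bar>\<close> to the others, where the weights are at least
  \<open>n\<^sup>2\<close>.\<close>

lemma cross_polytope_round:
  fixes \<delta> :: real
  assumes x: "x \<in> cross_polytope" and \<delta>: "\<delta> > 0" and n: "n > 0" and M: "1 \<le> \<delta> * (real M)\<^sup>2"
  obtains q :: "nat \<Rightarrow> int"
  where "(\<Sum>i<M. (real (Suc i))\<^sup>2 * \<bar>real_of_int (q i)\<bar>) \<le> 1 / \<delta>"
    and "(norm (x - l2_vec M (\<lambda>i. \<delta> * q i)))\<^sup>2 \<le> n * \<delta>\<^sup>2 + \<delta> / (real n)\<^sup>2"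
proof -
  let ?w = "\<lambda>i. (real (Suc i))\<^sup>2"
  have "\<forall>i. \<exists>k::int. \<bar>Rep_l2 x i - \<delta> * of_int k\<bar> \<le> \<delta>
      \<and> \<bar>Rep_l2 x i - \<delta> * of_int k\<bar> \<le> \<bar>Rep_l2 x i\<bar> \<and> \<delta> * \<bar>real_of_int k\<bar> \<le> \<bar>Rep_l2 x i\<bar>"
  proof
    fix i
    show "\<exists>k::int. \<bar>Rep_l2 x i - \<delta> * of_int k\<bar> \<le> \<delta>
        \<and> \<bar>Rep_l2 x i - \<delta> * of_int k\<bar> \<le> \<bar>Rep_l2 x i\<bar> \<and> \<delta> * \<bar>real_of_int k\<bar> \<le> \<bar>Rep_l2 x i\<bar>"
      using truncate_to_grid[OF \<delta>, of "Rep_l2 x i"] by auto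
  qed
  from choice[OF this] obtain q :: "nat \<Rightarrow> int" where q: "\<And>i. \<bar>Rep_l2 x i - \<delta> * of_int (q i)\<bar> \<le> \<delta>"
      "\<And>i. \<bar>Rep_l2 x i - \<delta> * of_int (q i)\<bar> \<le> \<bar>Rep_l2 x i\<bar>"
      "\<And>i. \<delta> * \<bar>real_of_int (q i)\<bar> \<le> \<bar>Rep_l2 x i\<bar>"
    by blast
  show ?thesis
  proof
    have "\<delta> * (\<Sum>i<M. ?w i * \<bar>real_of_int (q i)\<bar>) = (\<Sum>i<M. ?w i * (\<delta> * \<bar>real_of_int (q i)\<bar>))"
      by (simp add: sum_distrib_left mult_ac)
    also have "\<dots> \<le> (\<Sum>i<M. ?w i * \<bar>Rep_l2 x i\<bar>)"
      by (intro sum_mono mult_left_mono q) simp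
    also have "\<dots> \<le> 1" using x by (rule cross_polytopeD)
    finally show "(\<Sum>i<M. ?w i * \<bar>real_of_int (q i)\<bar>) \<le> 1 / \<delta>"
      using \<delta> by (simp add: field_simps)
    let ?d = "Rep_l2 (x - l2_vec M (\<lambda>i. \<delta> * q i))"
    have d: "\<bar>?d i\<bar> \<le> \<delta>" "\<bar>?d i\<bar> \<le> \<bar>Rep_l2 x i\<bar>" for i
    proof -
      \<comment> \<open>Coordinates from \<open>M\<close> on are replaced by 0; the hypothesis on
        \<open>M\<close> makes them at most \<open>\<delta>\<close>, so they obey the same error
        bounds as the rounded ones.\<close>
      have "\<bar>Rep_l2 x i\<bar> \<le> \<delta>" if "i \<ge> M"
      proof -
        have "(real M)\<^sup>2 * \<bar>Rep_l2 x i\<bar> \<le> ?w i * \<bar>Rep_l2 x i\<bar>"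
          using that by (intro mult_right_mono power_mono) auto
        also have "\<dots> \<le> 1" by (rule cross_polytope_coord_le[OF x])
        finally have "\<delta> * ((real M)\<^sup>2 * \<bar>Rep_l2 x i\<bar>) \<le> \<delta>" using \<delta> by simp
        moreover have "1 * \<bar>Rep_l2 x i\<bar> \<le> (\<delta> * (real M)\<^sup>2) * \<bar>Rep_l2 x i\<bar>"
          using M by (intro mult_right_mono) auto
        ultimately show ?thesis by (simp add: mult_ac)
      qed
      then show "\<bar>?d i\<bar> \<le> \<delta>" "\<bar>?d i\<bar> \<le> \<bar>Rep_l2 x i\<bar>"
        using q[of i] by (auto simp: minus_l2.rep_eq l2_vec.rep_eq)
    qed
    have le: "(?d i)\<^sup>2 \<le> (if i < n then \<delta>\<^sup>2 else 0) + \<delta> / (real n)\<^sup>2 * (?w i * \<bar>Rep_l2 x i\<bar>)" for i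
    proof (cases "i < n")
      case True
      have "(?d i)\<^sup>2 \<le> \<delta>\<^sup>2" using d(1)[of i] \<delta> by (simp flip: abs_le_square_iff)
      then show ?thesis using True \<delta> by (simp add: add_increasing2)
    next
      case False
      have "(?d i)\<^sup>2 = \<bar>?d i\<bar> * \<bar>?d i\<bar>" by (simp add: power2_eq_square)
      also have "\<dots> \<le> \<delta> * \<bar>Rep_l2 x i\<bar>" using d[of i] \<delta> by (intro mult_mono) auto
      also have "\<dots> \<le> \<delta> * ((?w i / (real n)\<^sup>2) * \<bar>Rep_l2 x i\<bar>)"
      proof -
        have "(real n)\<^sup>2 \<le> ?w i" using False by (intro power_mono) auto
        then have "1 \<le> ?w i / (real n)\<^sup>2" using n by simp
        then have "1 * \<bar>Rep_l2 x i\<bar> \<le> (?w i / (real n)\<^sup>2) * \<bar>Rep_l2 x i\<bar>" by (intro mult_right_mono) auto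
        then show ?thesis using \<delta> by (intro mult_left_mono) auto
      qed
      finally show ?thesis using False by simp
    qed
    show "(norm (x - l2_vec M (\<lambda>i. \<delta> * q i)))\<^sup>2 \<le> n * \<delta>\<^sup>2 + \<delta> / (real n)\<^sup>2"
      unfolding l2_norm_power2_le_iff
    proof
      fix N
      have "(\<Sum>i<N. (?d i)\<^sup>2) \<le> (\<Sum>i<N. (if i < n then \<delta>\<^sup>2 else 0) + \<delta> / (real n)\<^sup>2 * (?w i * \<bar>Rep_l2 x i\<bar>))"
        by (intro sum_mono le)
      also have "\<dots> = (\<Sum>i<N. if i < n then \<delta>\<^sup>2 else 0)
          + \<delta> / (real n)\<^sup>2 * (\<Sum>i<N. ?w i * \<bar>Rep_l2 x i\<bar>)"
        by (simp only: sum.distrib sum_distrib_left)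
      also have "\<dots> \<le> n * \<delta>\<^sup>2 + \<delta> / (real n)\<^sup>2 * 1"
        using \<delta> by (intro add_mono mult_left_mono cross_polytopeD[OF x] sum_if_less_le) auto
      finally show "(\<Sum>i<N. (?d i)\<^sup>2) \<le> n * \<delta>\<^sup>2 + \<delta> / (real n)\<^sup>2" by simp
    qed
  qed
qed

lemma cross_polytope_cover:
  assumes n: "n \<ge> 1"
  obtains z :: "nat \<Rightarrow> l2" where "cross_polytope \<subseteq> (\<Union>j<2 ^ n. cball (z j) (601 / ((real n)\<^sup>2 * sqrt n)))"
proof -
  \<comment> \<open>With \<open>s\<close> as below, \<open>s / \<delta> = n / 3\<close> and
    \<open>sqrt (2 / s) = n / 10\<close>, so the counting exponent is
    \<open>n * (1 / 3 + pi / 10)\<close>, just below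
    \<open>n * (2 / 3) \<le> n * ln 2\<close>.\<close>
  define \<delta> where "\<delta> = 600 / real n ^ 3"
  \<comment> \<open>This is large enough both for the cutoff condition
    \<open>1 \<le> \<delta> * M\<^sup>2\<close> and, since \<open>1 / \<delta> \<le> M\<close>, to
    bound every rounded coordinate.\<close>
  define M where "M = n ^ 3"
  define s where "s = 200 / (real n)\<^sup>2"
  define Q where "Q = {q \<in> {..<M} \<rightarrow>\<^sub>E {-int M..int M}.
      (\<Sum>i<M. (real (Suc i))\<^sup>2 * \<bar>real_of_int (q i)\<bar>) \<le> 1 / \<delta>}"
  have n0: "real n > 0" "n > 0" and n1: "1 \<le> real n ^ 3" using n by auto
  have \<delta>0: "\<delta> > 0" using n0 by (simp add: \<delta>_def)
  have "real (card Q) \<le> exp (s * (1 / \<delta>) + pi * sqrt (2 / s))"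
    unfolding Q_def using n0 by (intro card_int_cross_polytope_le) (simp add: s_def)
  also have "s * (1 / \<delta>) = real n / 3"
    using n0 by (simp add: s_def \<delta>_def power2_eq_square power3_eq_cube)
  also have "sqrt (2 / s) = real n / 10"
  proof (rule real_sqrt_unique)
    show "(real n / 10)\<^sup>2 = 2 / s" by (simp add: s_def power_divide)
  qed simp
  also have "exp (real n / 3 + pi * (real n / 10)) \<le> exp (n * ln 2)"
  proof -
    have "1 / 3 + pi / 10 \<le> ln 2" using ln2_ge_two_thirds pi_less_4 pi_approx by simp
    from mult_left_mono[OF this, of "real n"] show ?thesis by (simp add: algebra_simps)
  qed
  also have "\<dots> = real (2 ^ n)" by (simp add: exp_of_nat_mult)
  finally have card: "card Q \<le> 2 ^ n" by (simp only: of_nat_le_iff)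
  have "finite Q" unfolding Q_def
    by (rule finite_subset[of _ "{..<M} \<rightarrow>\<^sub>E {-int M..int M}"]) (auto intro!: finite_PiE)
  then obtain h where h: "bij_betw h {0..<card Q} Q" using ex_bij_betw_nat_finite by blast
  show ?thesis
  proof
    show "cross_polytope \<subseteq> (\<Union>j<2 ^ n. cball (l2_vec M (\<lambda>i. \<delta> * h j i)) (601 / ((real n)\<^sup>2 * sqrt n)))"
    proof
      fix x assume x: "x \<in> cross_polytope"
      have "\<delta> * (real M)\<^sup>2 = 600 * real n ^ 3"
        using n0 by (simp add: \<delta>_def M_def field_simps flip: power_add power_mult)
      then have M1: "1 \<le> \<delta> * (real M)\<^sup>2" using n1 by simp
      obtain q where q: "(\<Sum>i<M. (real (Suc i))\<^sup>2 * \<bar>real_of_int (q i)\<bar>) \<le> 1 / \<delta>"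
          "(norm (x - l2_vec M (\<lambda>i. \<delta> * q i)))\<^sup>2 \<le> n * \<delta>\<^sup>2 + \<delta> / (real n)\<^sup>2"
        using cross_polytope_round[OF x \<delta>0 n0(2) M1] by blast
      \<comment> \<open>Membership in \<open>Q\<close> asks for the value \<open>undefined\<close>
        outside \<open>{..<M}\<close>; \<open>l2_vec M\<close> ignores these indices.\<close>
      let ?q = "restrict q {..<M}"
      have "q i \<in> {-int M..int M}" if "i < M" for i
      proof -
        have "1 * \<bar>real_of_int (q i)\<bar> \<le> (real (Suc i))\<^sup>2 * \<bar>real_of_int (q i)\<bar>"
          by (intro mult_right_mono) auto
        also have "\<dots> \<le> (\<Sum>i<M. (real (Suc i))\<^sup>2 * \<bar>real_of_int (q i)\<bar>)"
          using that by (intro member_le_sum) auto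
        also have "\<dots> \<le> 1 / \<delta>" by (rule q(1))
        also have "\<dots> \<le> real M" by (simp add: \<delta>_def M_def)
        finally have "\<bar>q i\<bar> \<le> int M" by linarith
        then show ?thesis by auto
      qed
      then have "?q \<in> Q" using q(1) by (simp add: Q_def)
      then have "?q \<in> h ` {0..<card Q}" using h by (simp add: bij_betw_def)
      then obtain j where j: "j < card Q" "h j = ?q" by (metis atLeastLessThan_iff imageE)
      have "l2_vec M (\<lambda>i. \<delta> * ?q i) = l2_vec M (\<lambda>i. \<delta> * q i)"
        by transfer auto
      then have "(norm (x - l2_vec M (\<lambda>i. \<delta> * h j i)))\<^sup>2 \<le> n * \<delta>\<^sup>2 + \<delta> / (real n)\<^sup>2"
        using q(2) j(2) by simp
      \<comment> \<open>The numerator is \<open>600\<^sup>2 + 600\<close>, which is below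
        \<open>601\<^sup>2\<close>.\<close>
      also have "\<dots> = 360600 / real n ^ 5"
        using n0 by (simp add: \<delta>_def field_simps power_numeral_reduce)
      also have "\<dots> \<le> 601\<^sup>2 / real n ^ 5" by (intro divide_right_mono) auto
      also have "\<dots> = (601 / ((real n)\<^sup>2 * sqrt n))\<^sup>2"
        by (simp add: power_divide power_mult_distrib power_numeral_reduce)
      finally have "norm (x - l2_vec M (\<lambda>i. \<delta> * h j i)) \<le> 601 / ((real n)\<^sup>2 * sqrt n)"
        by (rule power2_le_imp_le) simp
      then show "x \<in> (\<Union>j<2 ^ n. cball (l2_vec M (\<lambda>i. \<delta> * h j i)) (601 / ((real n)\<^sup>2 * sqrt n)))"
        using j(1) card by (auto simp: dist_norm norm_minus_commute intro!: bexI[of _ j])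
    qed
  qed
qed

section \<open>Compactness and comparison of the two rates\<close>

text \<open>The covers already constructed have radius of order \<open>n\<close> to the power -5/2,
  which tends to 0; this gives total boundedness, and closedness in l2 gives completeness.\<close>

lemma compact_cross_polytope: "compact cross_polytope"
  unfolding compact_eq_totally_bounded
proof (intro conjI allI impI)
  show "complete cross_polytope"
    using closed_cross_polytope by (simp add: complete_eq_closed)
  fix e :: real assume "e > 0"
  obtain n0 where "601 / e < real n0" using reals_Archimedean2 by blast
  then have "601 / e < real (Suc n0)" by simp
  then obtain n where n: "n \<ge> 1" "601 / e < real n" by (metis le_add1 plus_1_eq_Suc)
  have "1 * real n * 1 \<le> real n * real n * sqrt n"
    using n by (intro mult_mono) auto
  then have "601 / ((real n)\<^sup>2 * sqrt n) \<le> 601 / real n"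
    using n by (intro divide_left_mono) (auto simp: power2_eq_square)
  also have "\<dots> < e" using n \<open>e > 0\<close> by (simp add: field_simps)
  finally have r: "601 / ((real n)\<^sup>2 * sqrt n) < e" .
  obtain z :: "nat \<Rightarrow> l2"
    where z: "cross_polytope \<subseteq> (\<Union>j<2 ^ n. cball (z j) (601 / ((real n)\<^sup>2 * sqrt n)))"
    by (rule cross_polytope_cover[OF n(1)])
  have "cross_polytope \<subseteq> (\<Union>c\<in>z ` {..<2 ^ n}. ball c e)"
  proof
    fix x assume "x \<in> cross_polytope"
    with z obtain j where "j < 2 ^ n" "dist (z j) x \<le> 601 / ((real n)\<^sup>2 * sqrt n)" by auto
    with r show "x \<in> (\<Union>c\<in>z ` {..<2 ^ n}. ball c e)" by (auto intro!: bexI[of _ j])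
  qed
  then show "\<exists>k. finite k \<and> cross_polytope \<subseteq> (\<Union>x\<in>k. ball x e)" by blast
qed

lemma entropy_number_cross_polytope_bounds:
  assumes n: "n \<ge> 1"
  shows "entropy_number cross_polytope n \<le> 601 / ((real n)\<^sup>2 * sqrt n)"
    and "sqrt (2 * n) / (2 * (2 * real n) ^ 3) \<le> entropy_number cross_polytope n"
proof -
  let ?E = "{\<epsilon>. 0 < \<epsilon> \<and> (\<exists>z :: nat \<Rightarrow> l2. cross_polytope \<subseteq> (\<Union>i<2 ^ n. cball (z i) \<epsilon>))}"
  obtain z :: "nat \<Rightarrow> l2"
    where "cross_polytope \<subseteq> (\<Union>j<2 ^ n. cball (z j) (601 / ((real n)\<^sup>2 * sqrt n)))"
    by (rule cross_polytope_cover[OF n])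
  moreover have "0 < 601 / ((real n)\<^sup>2 * sqrt n)" using n by simp
  \<comment> \<open>Besides the upper bound, this supplies the nonemptiness needed to bound the
    infimum from below.\<close>
  ultimately have mem: "601 / ((real n)\<^sup>2 * sqrt n) \<in> ?E" by blast
  show "entropy_number cross_polytope n \<le> 601 / ((real n)\<^sup>2 * sqrt n)"
    unfolding entropy_number_def by (rule cInf_lower[OF mem]) (auto intro: bdd_belowI[of _ 0])
  show "sqrt (2 * n) / (2 * (2 * real n) ^ 3) \<le> entropy_number cross_polytope n"
    unfolding entropy_number_def
    using mem cross_polytope_cover_radius_ge[OF n] by (intro cInf_greatest) blast+
qed

theorem proposition2p1:
  "\<exists>K :: l2 set.
     (\<forall>x\<in>K. - x \<in> K) \<and> convex K \<and> compact K \<and> (\<exists>x\<in>K. x \<noteq> 0) \<and>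
     (\<exists>c>0. \<exists>C>0. \<forall>f. greedy_run K f \<longrightarrow>
        (\<forall>n\<ge>1. c * sqrt (real n) * entropy_number K n \<le> greedy_error K f n \<and>
               greedy_error K f n \<le> C * sqrt (real n) * entropy_number K n))"
proof (rule exI[of _ cross_polytope], intro conjI)
  show "\<forall>x\<in>cross_polytope. - x \<in> cross_polytope"
    by (simp add: uminus_in_cross_polytope)
  show "convex cross_polytope" "compact cross_polytope"
    by (fact convex_cross_polytope compact_cross_polytope)+
  show "\<exists>x\<in>cross_polytope. x \<noteq> 0"
  proof -
    obtain v where v: "v \<in> cross_polytope" "infdist v (coord_space 0) = 1 / (real (Suc 0))\<^sup>2"
      by (rule cross_polytope_vertex)
    have "0 \<in> coord_space 0" by (simp add: coord_space_def zero_l2.rep_eq)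
    with v(2) have "v \<noteq> 0" by auto
    with v(1) show ?thesis by blast
  qed
  show "\<exists>c>0. \<exists>C>0. \<forall>f. greedy_run cross_polytope f \<longrightarrow>
      (\<forall>n\<ge>1. c * sqrt (real n) * entropy_number cross_polytope n \<le> greedy_error cross_polytope f n \<and>
        greedy_error cross_polytope f n \<le> C * sqrt (real n) * entropy_number cross_polytope n)"
  \<comment> \<open>Here \<open>2404 = 4 * 601\<close>, the 4 coming from
    \<open>Suc n \<le> 2 * n\<close>, and \<open>16 = 2 * 2 ^ 3\<close> is the denominator of the
    lower entropy bound after weakening \<open>sqrt (2 * n)\<close> to
    \<open>sqrt n\<close>.\<close>
  proof (rule exI[of _ "1 / 2404"], rule conjI, simp, rule exI[of _ 16], intro conjI allI impI)
    fix f :: "nat \<Rightarrow> l2" and n :: nat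
    assume f: "greedy_run cross_polytope f" and n: "1 \<le> n"
    note bounds = entropy_number_cross_polytope_bounds[OF n]
    have \<sigma>: "greedy_error cross_polytope f n = 1 / (real (Suc n))\<^sup>2"
      by (rule greedy_error_cross_polytope[OF f])
    have "sqrt n * entropy_number cross_polytope n \<le> sqrt n * (601 / ((real n)\<^sup>2 * sqrt n))"
      by (intro mult_left_mono bounds) simp
    also have "\<dots> = 601 * (1 / (real n)\<^sup>2)" using n by simp
    also have "1 / (real n)\<^sup>2 \<le> 4 * (1 / (real (Suc n))\<^sup>2)"
    proof -
      have "(real (Suc n))\<^sup>2 \<le> (2 * real n)\<^sup>2" using n by (intro power_mono) auto
      then show ?thesis using n by (simp add: field_simps)
    qed
    finally show "1 / 2404 * sqrt n * entropy_number cross_polytope n \<le> greedy_error cross_polytope f n"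
      unfolding \<sigma> by simp
    have "1 / (real (Suc n))\<^sup>2 \<le> 1 / (real n)\<^sup>2"
      using n by (intro divide_left_mono power_mono) auto
    also have "\<dots> = 16 * (sqrt n * (sqrt n / (2 * (2 * real n) ^ 3)))"
      using n by (simp add: field_simps power2_eq_square power3_eq_cube)
    also have "\<dots> \<le> 16 * (sqrt n * (sqrt (2 * n) / (2 * (2 * real n) ^ 3)))"
      by (intro mult_left_mono divide_right_mono) auto
    also have "\<dots> \<le> 16 * (sqrt n * entropy_number cross_polytope n)"
      by (intro mult_left_mono bounds) auto
    finally show "greedy_error cross_polytope f n \<le> 16 * sqrt n * entropy_number cross_polytope n"
      unfolding \<sigma> by simp
  qed simp
qed

end
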